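(* For integers $r\ge 2$, $k\ge 2$, let $W(r,k)$ be the van der Waerden number and write its base-$k$ expansion $W(r,k)=c_m k^m+c_{m-1}k^{m-1}+\cdots+c_0\in[k^m,k^{m+1})$, where $m=m(r,k)$ is a positive integer, $c_m\in\{1,\dots,k-1\}$ and $c_{m-1},\dots,c_0\in\{0,\dots,k-1\}$. Then for large $k$, $k^m$ and $W(r,k)$, as these increase without bound, $\log_k W(r,k)=m+O(1)$; that is, there exist constants $C,M>0$ such that $|\log_k W(r,k)-m(r,k)|\le C$ for all $r,k\ge 2$ for which $k$, $k^{m(r,k)}$ and $W(r,k)$ are all at least $M$.
   Context: The van der Waerden number $W(r,k)$ is the least positive integer $W$ such that every coloring of the integers $1,\dots,W$ with $r$ colors contains a monochromatic arithmetic progression with $k$ terms. *)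

theory Defs
  imports Complex_Main "HOL-Library.FuncSet"
begin

definition has_mono_AP :: "(nat \<Rightarrow> nat) \<Rightarrow> nat \<Rightarrow> nat \<Rightarrow> bool" where
  "has_mono_AP f k W \<longleftrightarrow>
     (\<exists>a d col. d > 0 \<and> (\<forall>i<k. a + i * d \<in> {1..W} \<and> f (a + i * d) = col))"

text \<open>An \<open>r\<close>-colouring is a map into an \<open>r\<close>-element set of colours; it need not use all of them.\<close>

definition vdW :: "nat \<Rightarrow> nat \<Rightarrow> nat" where
  "vdW r k = (LEAST W. W > 0 \<and> (\<forall>f \<in> {1..W} \<rightarrow> {1..r}. has_mono_AP f k W))"

text \<open>\<open>base_expansion k n m c\<close>: \<open>n\<close> has a base-\<open>k\<close> expansion with positive leading exponent \<open>m\<close>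
  and digits \<open>c m, \<dots>, c 0\<close>. Values of \<open>c\<close> beyond \<open>m\<close> are irrelevant.\<close>

definition base_expansion :: "nat \<Rightarrow> nat \<Rightarrow> nat \<Rightarrow> (nat \<Rightarrow> nat) \<Rightarrow> bool" where
  "base_expansion k n m c \<longleftrightarrow>
     m > 0 \<and> c m \<in> {1..k - 1} \<and> (\<forall>i<m. c i \<in> {0..k - 1}) \<and>
     n = (\<Sum>i\<le>m. c i * k ^ i) \<and> n \<in> {k ^ m..<k ^ (m + 1)}"

text \<open>The exponent is uniquely determined, and it exists for \<open>r, k \<ge> 2\<close> because
  \<open>vdW r k \<ge> k\<close>.\<close>

definition vdW_exponent :: "nat \<Rightarrow> nat \<Rightarrow> nat" where
  "vdW_exponent r k = (THE m. \<exists>c. base_expansion k (vdW r k) m c)"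

end

theory Submission
  imports Defs
begin

text \<open>
  The leading exponent of the base-\<open>k\<close> expansion of \<open>W\<close> is the \<open>m\<close> with
  \<open>k ^ m \<le> W < k ^ (m + 1)\<close>, so \<open>log k W\<close> lies in \<open>[m, m + 1)\<close> and \<open>C = 1\<close> works.
  What remains is that \<open>vdW r k\<close> has an expansion with positive leading exponent, that is,
  \<open>vdW r k \<ge> k\<close>: a progression of \<open>k\<close> distinct terms needs at least \<open>k\<close> places
  (\<open>vdW_ge\<close>), and every \<open>n \<ge> k\<close> has such an expansion (\<open>base_expansion_exists\<close>).

  The lower bound \<open>vdW_ge\<close> speaks of pairs \<open>(r, k)\<close> for which some \<open>W\<close> forces a monochromatic
  progression. For any other pair, \<open>vdW r k\<close> would be the least element of the empty set, an
  unspecified number that is the same for all such pairs. The claim concerns only values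
  \<open>vdW r k \<ge> M\<close>, so taking \<open>M\<close> above this number leaves only pairs covered by \<open>vdW_ge\<close>.
\<close>

text \<open>The constant colouring already gives the bound: some progression of \<open>k\<close> distinct terms
  has to fit into \<open>{1..vdW r k}\<close>.\<close>

lemma vdW_ge:
  assumes W: "W > 0" "\<forall>f \<in> {1..W} \<rightarrow> {1..r}. has_mono_AP f k W"
    and "r \<ge> 1" "k \<ge> 1"
  shows "k \<le> vdW r k"
proof -
  have forced: "\<forall>f \<in> {1..vdW r k} \<rightarrow> {1..r}. has_mono_AP f k (vdW r k)"
    unfolding vdW_def by (rule LeastI2[of _ W]) (use W in auto)
  have "(\<lambda>_. 1) \<in> {1..vdW r k} \<rightarrow> {1..r}"
    using \<open>r \<ge> 1\<close> by auto
  with forced have "has_mono_AP (\<lambda>_. 1) k (vdW r k)" by blast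
  then obtain a d where "d > 0" and ap: "\<forall>i<k. a + i * d \<in> {1..vdW r k}"
    unfolding has_mono_AP_def by blast
  have "1 \<le> a" and last: "a + (k - 1) * d \<le> vdW r k"
    using ap[rule_format, of 0] ap[rule_format, of "k - 1"] \<open>k \<ge> 1\<close> by auto
  have "k - 1 \<le> (k - 1) * d" using \<open>d > 0\<close> by simp
  with \<open>1 \<le> a\<close> last show ?thesis by linarith
qed

text \<open>Truncated expansion: once the quotient \<open>n div k ^ j\<close> is itself smaller than \<open>k\<close>,
  it serves as the leading digit.\<close>

lemma sum_digits_plus_quotient:
  fixes n k :: nat
  shows "(\<Sum>i<j. (n div k ^ i mod k) * k ^ i) + (n div k ^ j) * k ^ j = n"
proof (induction j)
  case (Suc j)
  have "(n div k ^ j mod k) * k ^ j + (n div k ^ Suc j) * k ^ Suc j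
      = ((n div k ^ j) mod k + (n div k ^ j) div k * k) * k ^ j"
    by (simp add: algebra_simps div_mult2_eq[symmetric])
  also have "\<dots> = (n div k ^ j) * k ^ j" by (simp only: mod_div_mult_eq)
  finally show ?case using Suc by simp
qed simp

lemma base_expansion_exists:
  fixes n k :: nat
  assumes "k \<ge> 2" "k \<le> n"
  shows "\<exists>m c. base_expansion k n m c"
proof -
  obtain m where m: "k ^ m \<le> n" "n < k ^ (m + 1)"
    using ex_power_ivl1[of k n] assms by auto
  define c where "c i = n div k ^ i mod k" for i
  have "m > 0" using m assms by (cases m) auto
  have "n div k ^ m < k"
    using m assms by (simp add: less_mult_imp_div_less)
  then have cm: "c m = n div k ^ m" by (simp add: c_def)
  then have lead: "c m \<in> {1..k - 1}"
    using m assms \<open>n div k ^ m < k\<close> by (auto simp: Suc_le_eq div_greater_zero_iff)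
  have digits: "\<forall>i<m. c i \<in> {0..k - 1}"
    using assms by (auto simp: c_def less_Suc_eq_le[symmetric])
  have "n = (\<Sum>i\<le>m. c i * k ^ i)"
    using sum_digits_plus_quotient[of n k m] cm
    by (simp add: c_def lessThan_Suc_atMost[symmetric])
  with \<open>m > 0\<close> lead digits m show ?thesis
    unfolding base_expansion_def by auto
qed

lemma base_expansion_exponent_unique:
  assumes "k \<ge> 2" "base_expansion k n m c" "base_expansion k n m' c'"
  shows "m = m'"
proof -
  have "k ^ m < k ^ (m' + 1)" "k ^ m' < k ^ (m + 1)"
    using assms(2,3) unfolding base_expansion_def by auto
  then have "m < m' + 1" "m' < m + 1"
    using power_less_imp_less_exp[of k m "m' + 1"] power_less_imp_less_exp[of k m' "m + 1"] assms(1)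
    by linarith+
  then show ?thesis by simp
qed

lemma vdW_exponent_bounds:
  assumes "k \<ge> 2" "k \<le> vdW r k"
  shows "k ^ vdW_exponent r k \<le> vdW r k" "vdW r k < k ^ (vdW_exponent r k + 1)"
proof -
  have "\<exists>!m. \<exists>c. base_expansion k (vdW r k) m c"
    using base_expansion_exists[OF assms] base_expansion_exponent_unique[OF assms(1)] by blast
  then have "\<exists>c. base_expansion k (vdW r k) (vdW_exponent r k) c"
    unfolding vdW_exponent_def by (rule theI')
  then show "k ^ vdW_exponent r k \<le> vdW r k" "vdW r k < k ^ (vdW_exponent r k + 1)"
    unfolding base_expansion_def by auto
qed

theorem theorem2p2:
  "\<exists>C M :: real. C > 0 \<and> M > 0 \<and>
     (\<forall>r k :: nat. r \<ge> 2 \<longrightarrow> k \<ge> 2 \<longrightarrow>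
        real k \<ge> M \<longrightarrow> real k ^ vdW_exponent r k \<ge> M \<longrightarrow> real (vdW r k) \<ge> M \<longrightarrow>
        \<bar>log (real k) (real (vdW r k)) - real (vdW_exponent r k)\<bar> \<le> C)"
proof -
  define least_of_empty :: nat where "least_of_empty = (LEAST W. False)"
  define M where "M = real least_of_empty + 1"
  have bound: "\<bar>log (real k) (real (vdW r k)) - real (vdW_exponent r k)\<bar> \<le> 1"
    if "r \<ge> 2" "k \<ge> 2" "real (vdW r k) \<ge> M" for r k
  proof -
    have "\<exists>W>0. \<forall>f \<in> {1..W} \<rightarrow> {1..r}. has_mono_AP f k W"
    proof (rule ccontr)
      assume "\<not> ?thesis"
      \<comment> \<open>The predicate under \<open>LEAST\<close> is then the constantly false one, whatever
        \<open>r\<close> and \<open>k\<close> are.\<close>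
      then have "(\<lambda>W. W > 0 \<and> (\<forall>f \<in> {1..W} \<rightarrow> {1..r}. has_mono_AP f k W)) = (\<lambda>W. False)"
        by (intro ext) blast
      then have "vdW r k = least_of_empty"
        unfolding vdW_def least_of_empty_def by (rule arg_cong)
      with \<open>real (vdW r k) \<ge> M\<close> show False by (simp add: M_def)
    qed
    then have "k \<le> vdW r k" using vdW_ge[of _ r k] that by auto
    note bounds = vdW_exponent_bounds[OF \<open>k \<ge> 2\<close> this]
    have "real k ^ vdW_exponent r k \<le> real (vdW r k)"
      using bounds(1) by (metis of_nat_le_iff of_nat_power)
    then have lower: "real (vdW_exponent r k) \<le> log (real k) (real (vdW r k))"
      by (rule le_log_of_power) (use \<open>k \<ge> 2\<close> in simp)
    have "real (vdW r k) < real k ^ (vdW_exponent r k + 1)"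
      using bounds(2) by (metis of_nat_less_iff of_nat_power)
    then have "log (real k) (real (vdW r k)) < real (vdW_exponent r k + 1)"
      by (rule log_of_power_less) (use \<open>k \<ge> 2\<close> \<open>k \<le> vdW r k\<close> in auto)
    with lower show ?thesis by simp
  qed
  moreover have "M > 0" by (simp add: M_def)
  ultimately show ?thesis
    by (intro exI[of _ 1] exI[of _ M]) auto
qed

end
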